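(* Let $(X,\rho)$ be a complete metric space and let $A_x,A_y\subseteq X$ be nonempty and closed. Let $D\subseteq A_x\times A_y$ be a nonempty closed subset and let $F:D\to A_x$, $f:D\to A_y$ be maps such that $(F(x,y),f(x,y))\in D$ for every $(x,y)\in D$. Suppose that the ordered pair $(F,f)$ is a cyclic contraction of type one, with non-negative constants $\alpha,\beta,\gamma,\delta$, $\max\{\alpha+\gamma,\beta+\delta\}<1$, and put $k=\max\{\alpha+\gamma,\beta+\delta\}$. Then: (I) There exists a unique pair $(\xi,\eta)\in D$ which is a coupled fixed point of $(F,f)$, i.e. $\xi=F(\xi,\eta)$ and $\eta=f(\xi,\eta)$. Moreover, for every initial guess $(x,y)\in D$ the iteration sequences $\{x_n\}_{n=0}^\infty$ and $\{y_n\}_{n=0}^\infty$ converge to $\xi$ and $\eta$ respectively. Furthermore, for every initial guess $(x,y)\in D$: (II) (a priori error estimate) for all $n\ge 0$, $$\max\{\rho(x_n,\xi),\rho(y_n,\eta)\}\le \frac{k^n}{1-k}\bigl(\rho(x_1,x_0)+\rho(y_1,y_0)\bigr);$$ (III) (a posteriori error estimate) for all $n\ge 1$, $$\max\{\rho(x_n,\xi),\rho(y_n,\eta)\}\le \frac{k}{1-k}\bigl(\rho(x_{n-1},x_n)+\rho(y_{n-1},y_n)\bigr);$$ (IV) (rate of convergence) for all $n\ge 1$, $$\rho(x_n,\xi)+\rho(y_n,\eta)\le k\bigl(\rho(x_{n-1},\xi)+\rho(y_{n-1},\eta)\bigr).$$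
   Context: Let $A_x,A_y$ be nonempty subsets of a metric space $(X,\rho)$, $D\subseteq A_x\times A_y$, and $F:D\to A_x$, $f:D\to A_y$ with $(F(x,y),f(x,y))\in D$ for every $(x,y)\in D$. Cyclic contraction of type one: the ordered pair $(F,f)$ is a cyclic contraction of type one if there exist non-negative numbers $\alpha,\beta,\gamma,\delta$ with $\max\{\alpha+\gamma,\beta+\delta\}<1$ such that $$\rho(F(x,y),F(u,v))+\rho(f(z,w),f(t,s))\le \alpha\rho(x,u)+\beta\rho(y,v)+\gamma\rho(z,t)+\delta\rho(w,s)$$ for all $(x,y),(u,v),(z,w),(t,s)\in D$. Iteration sequences: for an initial guess $(x,y)\in D$, put $x_0=x$, $y_0=y$ and $x_{n+1}=F(x_n,y_n)$, $y_{n+1}=f(x_n,y_n)$ for all $n\ge 0$. Closedness of $D$ is with respect to the product topology on $X\times X$. The convention $0^0=1$ is used. *)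

theory Defs
  imports "HOL-Analysis.Analysis"
begin

text \<open>
  The maps \<open>F\<close> and \<open>f\<close> are total functions on pairs; only their values on \<open>D\<close> matter.
\<close>

text \<open>
  The constants are parameters because error estimates refer to them: the pair \<open>(F, f)\<close> is a
  cyclic contraction of type one iff this predicate holds for some \<open>\<alpha> \<beta> \<gamma> \<delta>\<close>.
\<close>

definition cyclic_contraction_type_one ::
  "('a::metric_space \<times> 'a) set \<Rightarrow> ('a \<times> 'a \<Rightarrow> 'a) \<Rightarrow> ('a \<times> 'a \<Rightarrow> 'a) \<Rightarrow>
     real \<Rightarrow> real \<Rightarrow> real \<Rightarrow> real \<Rightarrow> bool"
where
  "cyclic_contraction_type_one D F f \<alpha> \<beta> \<gamma> \<delta> \<longleftrightarrow>
     0 \<le> \<alpha> \<and> 0 \<le> \<beta> \<and> 0 \<le> \<gamma> \<and> 0 \<le> \<delta> \<and> max (\<alpha> + \<gamma>) (\<beta> + \<delta>) < 1 \<and>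
     (\<forall>x y u v z w t s. (x, y) \<in> D \<longrightarrow> (u, v) \<in> D \<longrightarrow> (z, w) \<in> D \<longrightarrow> (t, s) \<in> D \<longrightarrow>
        dist (F (x, y)) (F (u, v)) + dist (f (z, w)) (f (t, s))
          \<le> \<alpha> * dist x u + \<beta> * dist y v + \<gamma> * dist z t + \<delta> * dist w s)"

definition coupled_fixed_point :: "('a \<times> 'a \<Rightarrow> 'a) \<Rightarrow> ('a \<times> 'a \<Rightarrow> 'a) \<Rightarrow> 'a \<times> 'a \<Rightarrow> bool"
where
  "coupled_fixed_point F f p \<longleftrightarrow> fst p = F p \<and> snd p = f p"

fun iter_x :: "('a \<times> 'a \<Rightarrow> 'a) \<Rightarrow> ('a \<times> 'a \<Rightarrow> 'a) \<Rightarrow> 'a \<Rightarrow> 'a \<Rightarrow> nat \<Rightarrow> 'a"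
  and iter_y :: "('a \<times> 'a \<Rightarrow> 'a) \<Rightarrow> ('a \<times> 'a \<Rightarrow> 'a) \<Rightarrow> 'a \<Rightarrow> 'a \<Rightarrow> nat \<Rightarrow> 'a"
where
  "iter_x F f x y 0 = x"
| "iter_x F f x y (Suc n) = F (iter_x F f x y n, iter_y F f x y n)"
| "iter_y F f x y 0 = y"
| "iter_y F f x y (Suc n) = f (iter_x F f x y n, iter_y F f x y n)"

end

theory Submission
  imports Defs
begin

text \<open>
  Evaluating the type-one condition with \<open>(z, w) = (x, y)\<close> and \<open>(t, s) = (u, v)\<close> shows that
  \<open>T p = (F p, f p)\<close> is an ordinary \<open>k\<close>-contraction of \<open>D\<close> for the sum metric
  \<open>d ((x, y), (u, v)) = \<rho> (x, u) + \<rho> (y, v)\<close>. A coupled fixed point is a fixed point of \<open>T\<close>,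
  and the two iteration sequences are the components of the orbit of \<open>T\<close>, so the theorem is
  Banach's principle for \<open>T\<close> together with its error estimates. The type \<open>'a \<times> 'a\<close> carries the
  Euclidean product metric, for which \<open>T\<close> need not be a contraction; hence the argument is
  carried out for \<open>d\<close>, which dominates that metric.

  Everything rests on one inequality, valid for all \<open>p, q \<in> D\<close>
  (\<open>contraction_inequality\<close>):
  \<open>(1 - k) d (p, q) \<le> d (p, T p) + d (q, T q)\<close>. It follows from \<open>d (p, q) \<le> d (p, T p) + d (T p, T q) + d (T q, q)\<close>. Along an orbit the
  right-hand side decays geometrically, so orbits are Cauchy; for two fixed points it vanishes,
  so fixed points are unique; and with \<open>q\<close> a fixed point it bounds the distance from \<open>p\<close> to \<open>q\<close>
  by the first step \<open>d (p, T p)\<close>, from which both error estimates follow.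
\<close>

definition sum_dist :: "'a::metric_space \<times> 'a \<Rightarrow> 'a \<times> 'a \<Rightarrow> real"
  where "sum_dist p q = dist (fst p) (fst q) + dist (snd p) (snd q)"

lemma sum_dist_commute: "sum_dist p q = sum_dist q p"
  by (simp add: sum_dist_def dist_commute)

lemma sum_dist_triangle: "sum_dist p r \<le> sum_dist p q + sum_dist q r"
  unfolding sum_dist_def
  using dist_triangle[of "fst p" "fst r" "fst q"] dist_triangle[of "snd p" "snd r" "snd q"]
  by linarith

lemma dist_le_sum_dist: "dist p q \<le> sum_dist p q"
  unfolding sum_dist_def dist_prod_def by (rule sqrt_sum_squares_le_sum) auto

lemma max_dist_le_sum_dist:
  "max (dist (fst p) (fst q)) (dist (snd p) (snd q)) \<le> sum_dist p q"
  by (simp add: sum_dist_def)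

lemma sum_dist_tendsto_0:
  assumes "p \<longlonglongrightarrow> q"
  shows "(\<lambda>n. sum_dist (p n) q) \<longlonglongrightarrow> 0"
proof -
  have "(\<lambda>n. dist (fst (p n)) (fst q) + dist (snd (p n)) (snd q)) \<longlonglongrightarrow> 0 + 0"
    by (intro tendsto_add tendsto_dist_iff[THEN iffD1] tendsto_fst tendsto_snd assms)
  then show ?thesis
    by (simp add: sum_dist_def)
qed

lemma tendsto_of_sum_dist_le:
  assumes "\<And>n. sum_dist (p n) q \<le> b n" and "b \<longlonglongrightarrow> 0"
  shows "p \<longlonglongrightarrow> q"
proof -
  have "(\<lambda>n. dist (p n) q) \<longlonglongrightarrow> 0"
  proof (rule tendsto_sandwich[OF _ _ tendsto_const assms(2)])
    show "\<forall>\<^sub>F n in sequentially. dist (p n) q \<le> b n"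
      using order_trans[OF dist_le_sum_dist assms(1)] by (intro always_eventually) blast
  qed simp
  then show ?thesis
    by (rule tendsto_dist_iff[THEN iffD2])
qed

locale sum_dist_contraction =
  fixes D :: "('a::metric_space \<times> 'a) set" and T :: "'a \<times> 'a \<Rightarrow> 'a \<times> 'a" and k :: real
  assumes maps_to: "p \<in> D \<Longrightarrow> T p \<in> D"
    and contracts: "p \<in> D \<Longrightarrow> q \<in> D \<Longrightarrow> sum_dist (T p) (T q) \<le> k * sum_dist p q"
    and k_nonneg: "0 \<le> k" and k_less_1: "k < 1"
begin

text \<open>
  Go from \<open>p\<close> to \<open>q\<close> through \<open>T p\<close> and \<open>T q\<close>: the middle leg costs at most \<open>k\<close> times the
  distance being estimated, which is then absorbed on the left.
\<close>

lemma contraction_inequality: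
  assumes "p \<in> D" "q \<in> D"
  shows "sum_dist p q \<le> (sum_dist p (T p) + sum_dist q (T q)) / (1 - k)"
proof -
  have "sum_dist p q \<le> sum_dist p (T p) + (sum_dist (T p) (T q) + sum_dist (T q) q)"
    using sum_dist_triangle[of p q "T p"] sum_dist_triangle[of "T p" q "T q"] by linarith
  also have "\<dots> \<le> sum_dist p (T p) + (k * sum_dist p q + sum_dist q (T q))"
    using contracts[OF assms] by (simp add: sum_dist_commute)
  finally show ?thesis
    using k_less_1 by (simp add: pos_le_divide_eq algebra_simps)
qed

lemma fixed_point_unique:
  assumes "p \<in> D" "T p = p" "q \<in> D" "T q = q"
  shows "p = q"
proof -
  have "sum_dist p q \<le> 0"
    using contraction_inequality[OF assms(1,3)] assms(2,4) by (simp add: sum_dist_def)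
  then have "dist p q \<le> 0"
    using dist_le_sum_dist[of p q] by linarith
  then show ?thesis
    by (simp only: dist_le_zero_iff)
qed

lemma orbit_in: "p \<in> D \<Longrightarrow> (T ^^ n) p \<in> D"
  by (induction n) (auto intro: maps_to)

lemma orbit_contracts:
  assumes "p \<in> D" "q \<in> D"
  shows "sum_dist ((T ^^ n) p) ((T ^^ n) q) \<le> k ^ n * sum_dist p q"
proof (induction n)
  case (Suc n)
  have "sum_dist ((T ^^ Suc n) p) ((T ^^ Suc n) q) \<le> k * sum_dist ((T ^^ n) p) ((T ^^ n) q)"
    using contracts[OF orbit_in orbit_in] assms by simp
  also have "\<dots> \<le> k * (k ^ n * sum_dist p q)"
    using Suc.IH k_nonneg by (rule mult_left_mono)
  finally show ?case
    by simp
qed simp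

lemma orbit_step_le:
  assumes "p \<in> D"
  shows "sum_dist ((T ^^ n) p) (T ((T ^^ n) p)) \<le> k ^ n * sum_dist p (T p)"
  using orbit_contracts[OF assms maps_to[OF assms]] by (simp add: funpow_swap1)

lemma geometric_bound_tendsto_0: "(\<lambda>n. k ^ n / (1 - k) * c) \<longlonglongrightarrow> 0"
proof -
  have "(\<lambda>n. k ^ n) \<longlonglongrightarrow> 0"
    using k_nonneg k_less_1 by (intro LIMSEQ_power_zero) simp
  then show ?thesis
    by (intro tendsto_mult_left_zero tendsto_divide_zero)
qed

text \<open>
  The contraction inequality compares two points of the orbit directly through their own next
  steps, so no geometric series has to be summed.
\<close>

lemma orbit_Cauchy:
  assumes "p \<in> D"
  shows "Cauchy (\<lambda>n. (T ^^ n) p)"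
proof (rule metric_CauchyI)
  fix e :: real
  assume "0 < e"
  define b where "b n = k ^ n / (1 - k) * sum_dist p (T p)" for n
  have "\<forall>\<^sub>F n in sequentially. b n < e / 2"
    using geometric_bound_tendsto_0[of "sum_dist p (T p)"] \<open>0 < e\<close>
    unfolding b_def by (intro order_tendstoD) auto
  then obtain N where N: "\<And>n. n \<ge> N \<Longrightarrow> b n < e / 2"
    by (auto simp: eventually_sequentially)
  have le: "dist ((T ^^ m) p) ((T ^^ n) p) \<le> b m + b n" for m n
  proof -
    have "dist ((T ^^ m) p) ((T ^^ n) p) \<le> sum_dist ((T ^^ m) p) ((T ^^ n) p)"
      by (rule dist_le_sum_dist)
    also have "\<dots> \<le> (sum_dist ((T ^^ m) p) (T ((T ^^ m) p))
                    + sum_dist ((T ^^ n) p) (T ((T ^^ n) p))) / (1 - k)"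
      by (intro contraction_inequality orbit_in assms)
    also have "\<dots> \<le> (k ^ m * sum_dist p (T p) + k ^ n * sum_dist p (T p)) / (1 - k)"
      using k_less_1 by (intro divide_right_mono add_mono orbit_step_le assms) auto
    also have "\<dots> = b m + b n"
      by (simp add: b_def add_divide_distrib)
    finally show ?thesis .
  qed
  have "dist ((T ^^ m) p) ((T ^^ n) p) < e" if "m \<ge> N" "n \<ge> N" for m n
    using le[of m n] N[OF that(1)] N[OF that(2)] by linarith
  then show "\<exists>N. \<forall>m\<ge>N. \<forall>n\<ge>N. dist ((T ^^ m) p) ((T ^^ n) p) < e"
    by blast
qed

text \<open>
  The limit \<open>q\<close> of an orbit is fixed because the shifted orbit tends both to \<open>q\<close> and, by the
  contraction property, to \<open>T q\<close>.
\<close>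

lemma fixed_point_exists:
  assumes "complete D" "D \<noteq> {}"
  shows "\<exists>q\<in>D. T q = q"
proof -
  obtain p where p: "p \<in> D"
    using assms(2) by blast
  obtain q where q: "q \<in> D" and lim: "(\<lambda>n. (T ^^ n) p) \<longlonglongrightarrow> q"
    using completeE[OF assms(1) _ orbit_Cauchy[OF p]] orbit_in[OF p] by metis
  have "(\<lambda>n. T ((T ^^ n) p)) \<longlonglongrightarrow> T q"
  proof (rule tendsto_of_sum_dist_le)
    show "sum_dist (T ((T ^^ n) p)) (T q) \<le> k * sum_dist ((T ^^ n) p) q" for n
      by (intro contracts orbit_in p q)
    show "(\<lambda>n. k * sum_dist ((T ^^ n) p) q) \<longlonglongrightarrow> 0"
      using tendsto_mult_right_zero[OF sum_dist_tendsto_0[OF lim]] .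
  qed
  moreover have "(\<lambda>n. T ((T ^^ n) p)) \<longlonglongrightarrow> q"
    using LIMSEQ_Suc[OF lim] by simp
  ultimately have "T q = q"
    by (rule LIMSEQ_unique)
  with q show ?thesis
    by blast
qed

lemma sum_dist_step_fixed_point:
  assumes "p \<in> D" "q \<in> D" "T q = q"
  shows "sum_dist (T p) q \<le> k * sum_dist p q"
  using contracts[OF assms(1,2)] assms(3) by simp

lemma a_priori_estimate:
  assumes "p \<in> D" "q \<in> D" "T q = q"
  shows "sum_dist ((T ^^ n) p) q \<le> k ^ n / (1 - k) * sum_dist p (T p)"
proof -
  have "(T ^^ n) q = q"
    by (induction n) (simp_all add: assms(3))
  then have "sum_dist ((T ^^ n) p) q \<le> k ^ n * sum_dist p q"
    using orbit_contracts[OF assms(1,2), of n] by simp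
  also have "\<dots> \<le> k ^ n * (sum_dist p (T p) / (1 - k))"
    using contraction_inequality[OF assms(1,2)] assms(3) k_nonneg
    by (intro mult_left_mono) (auto simp: sum_dist_def)
  finally show ?thesis
    by simp
qed

text \<open>
  This is the a priori estimate after one step, to be applied at an arbitrary point of the orbit.
\<close>

lemma a_posteriori_estimate:
  assumes "p \<in> D" "q \<in> D" "T q = q"
  shows "sum_dist (T p) q \<le> k / (1 - k) * sum_dist p (T p)"
  using a_priori_estimate[OF assms, of 1] by simp

end

lemma type_one_sum_dist_contraction:
  assumes "\<And>x y. (x, y) \<in> D \<Longrightarrow> (F (x, y), f (x, y)) \<in> D"
    and "cyclic_contraction_type_one D F f \<alpha> \<beta> \<gamma> \<delta>"
  shows "sum_dist_contraction D (\<lambda>p. (F p, f p)) (max (\<alpha> + \<gamma>) (\<beta> + \<delta>))"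
proof
  let ?k = "max (\<alpha> + \<gamma>) (\<beta> + \<delta>)"
  note c = assms(2)[unfolded cyclic_contraction_type_one_def]
  show "(F p, f p) \<in> D" if "p \<in> D" for p
    using assms(1)[of "fst p" "snd p"] that by simp
  show "0 \<le> ?k" "?k < 1"
    using c by auto
  show "sum_dist (F p, f p) (F q, f q) \<le> ?k * sum_dist p q" if "p \<in> D" "q \<in> D" for p q
  proof -
    obtain x y u v where pq: "p = (x, y)" "q = (u, v)"
      by fastforce
    have "dist (F p) (F q) + dist (f p) (f q)
        \<le> \<alpha> * dist x u + \<beta> * dist y v + \<gamma> * dist x u + \<delta> * dist y v"
      using c that unfolding pq by blast
    also have "\<dots> = (\<alpha> + \<gamma>) * dist x u + (\<beta> + \<delta>) * dist y v"
      by (simp add: algebra_simps)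
    also have "\<dots> \<le> ?k * dist x u + ?k * dist y v"
      by (intro add_mono mult_right_mono) auto
    finally show ?thesis
      by (simp add: pq sum_dist_def distrib_left)
  qed
qed

lemma funpow_eq_iter:
  "((\<lambda>p. (F p, f p)) ^^ n) (x, y) = (iter_x F f x y n, iter_y F f x y n)"
  by (induction n) auto

theorem theorem1:
  fixes A\<^sub>x A\<^sub>y :: "'a::complete_space set"
    and D :: "('a \<times> 'a) set"
    and F f :: "'a \<times> 'a \<Rightarrow> 'a"
    and \<alpha> \<beta> \<gamma> \<delta> k :: real
  assumes "A\<^sub>x \<noteq> {}" and "closed A\<^sub>x"
    and "A\<^sub>y \<noteq> {}" and "closed A\<^sub>y"
    and "D \<subseteq> A\<^sub>x \<times> A\<^sub>y" and "D \<noteq> {}" and "closed D"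
    and "F \<in> D \<rightarrow> A\<^sub>x" and "f \<in> D \<rightarrow> A\<^sub>y"
    and "\<And>x y. (x, y) \<in> D \<Longrightarrow> (F (x, y), f (x, y)) \<in> D"
    and "cyclic_contraction_type_one D F f \<alpha> \<beta> \<gamma> \<delta>"
    and "k = max (\<alpha> + \<gamma>) (\<beta> + \<delta>)"
  shows "(\<exists>!p. p \<in> D \<and> coupled_fixed_point F f p) \<and>
    (\<forall>\<xi> \<eta>. (\<xi>, \<eta>) \<in> D \<and> coupled_fixed_point F f (\<xi>, \<eta>) \<longrightarrow>
      (\<forall>x y. (x, y) \<in> D \<longrightarrow>
        iter_x F f x y \<longlonglongrightarrow> \<xi> \<and> iter_y F f x y \<longlonglongrightarrow> \<eta> \<and>
        (\<forall>n. max (dist (iter_x F f x y n) \<xi>) (dist (iter_y F f x y n) \<eta>)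
           \<le> k ^ n / (1 - k) *
             (dist (iter_x F f x y 1) (iter_x F f x y 0) +
              dist (iter_y F f x y 1) (iter_y F f x y 0))) \<and>
        (\<forall>n\<ge>1. max (dist (iter_x F f x y n) \<xi>) (dist (iter_y F f x y n) \<eta>)
           \<le> k / (1 - k) *
             (dist (iter_x F f x y (n - 1)) (iter_x F f x y n) +
              dist (iter_y F f x y (n - 1)) (iter_y F f x y n))) \<and>
        (\<forall>n\<ge>1. dist (iter_x F f x y n) \<xi> + dist (iter_y F f x y n) \<eta>
           \<le> k * (dist (iter_x F f x y (n - 1)) \<xi> +
                  dist (iter_y F f x y (n - 1)) \<eta>))))"
proof -
  define T where "T p = (F p, f p)" for p
  interpret sum_dist_contraction D T k
    using type_one_sum_dist_contraction[OF assms(10,11)] assms(12) by (simp add: T_def[abs_def])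
  have fixed_iff: "coupled_fixed_point F f p \<longleftrightarrow> T p = p" for p
    by (cases p) (auto simp: coupled_fixed_point_def T_def)
  have orbit: "(T ^^ n) (x, y) = (iter_x F f x y n, iter_y F f x y n)" for n x y
    using funpow_eq_iter[of n F f x y] by (simp add: T_def[abs_def])
  have "complete D"
    using assms(7) by (simp add: complete_eq_closed)
  then have "\<exists>!p. p \<in> D \<and> coupled_fixed_point F f p"
    using fixed_point_exists[OF _ assms(6)] fixed_point_unique unfolding fixed_iff by blast
  moreover
  {
    fix \<xi> \<eta> x y
    assume "(\<xi>, \<eta>) \<in> D" "coupled_fixed_point F f (\<xi>, \<eta>)" and xy: "(x, y) \<in> D"
    then have fp: "(\<xi>, \<eta>) \<in> D" "T (\<xi>, \<eta>) = (\<xi>, \<eta>)"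
      by (simp_all add: fixed_iff)
    let ?X = "iter_x F f x y" and ?Y = "iter_y F f x y"
    have in_D: "(?X n, ?Y n) \<in> D" for n
      using orbit_in[OF xy, of n] by (simp add: orbit)
    have step: "T (?X n, ?Y n) = (?X (Suc n), ?Y (Suc n))" for n
      by (simp add: T_def)
    have max_le: "max (dist a \<xi>) (dist b \<eta>) \<le> sum_dist (a, b) (\<xi>, \<eta>)" for a b
      using max_dist_le_sum_dist[of "(a, b)" "(\<xi>, \<eta>)"] by simp

    have prior: "sum_dist (?X n, ?Y n) (\<xi>, \<eta>)
        \<le> k ^ n / (1 - k) * (dist (?X 1) (?X 0) + dist (?Y 1) (?Y 0))" for n
      using a_priori_estimate[OF xy fp, of n]
      by (simp add: orbit) (simp add: T_def sum_dist_def dist_commute)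
    have "(\<lambda>n. (?X n, ?Y n)) \<longlonglongrightarrow> (\<xi>, \<eta>)"
      by (rule tendsto_of_sum_dist_le[OF prior geometric_bound_tendsto_0])
    then have "?X \<longlonglongrightarrow> \<xi>" "?Y \<longlonglongrightarrow> \<eta>"
      using tendsto_fst tendsto_snd by fastforce+
    moreover have "max (dist (?X n) \<xi>) (dist (?Y n) \<eta>)
        \<le> k ^ n / (1 - k) * (dist (?X 1) (?X 0) + dist (?Y 1) (?Y 0))" for n
      using max_le prior by (rule order_trans)
    moreover have "max (dist (?X n) \<xi>) (dist (?Y n) \<eta>)
        \<le> k / (1 - k) * (dist (?X (n - 1)) (?X n) + dist (?Y (n - 1)) (?Y n))"
      if "n \<ge> 1" for n
    proof -
      have "sum_dist (?X n, ?Y n) (\<xi>, \<eta>)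
          \<le> k / (1 - k) * sum_dist (?X (n - 1), ?Y (n - 1)) (?X n, ?Y n)"
        using a_posteriori_estimate[OF in_D fp, of "n - 1"] that by (simp only: step) simp
      with max_le show ?thesis
        by (rule order_trans[THEN order_trans]) (simp add: sum_dist_def)
    qed
    moreover have "dist (?X n) \<xi> + dist (?Y n) \<eta>
        \<le> k * (dist (?X (n - 1)) \<xi> + dist (?Y (n - 1)) \<eta>)" if "n \<ge> 1" for n
    proof -
      have "sum_dist (?X n, ?Y n) (\<xi>, \<eta>) \<le> k * sum_dist (?X (n - 1), ?Y (n - 1)) (\<xi>, \<eta>)"
        using sum_dist_step_fixed_point[OF in_D fp, of "n - 1"] that by (simp only: step) simp
      then show ?thesis
        by (simp add: sum_dist_def)
    qed
    ultimately have "?X \<longlonglongrightarrow> \<xi> \<and> ?Y \<longlonglongrightarrow> \<eta> \<and>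
        (\<forall>n. max (dist (?X n) \<xi>) (dist (?Y n) \<eta>)
           \<le> k ^ n / (1 - k) * (dist (?X 1) (?X 0) + dist (?Y 1) (?Y 0))) \<and>
        (\<forall>n\<ge>1. max (dist (?X n) \<xi>) (dist (?Y n) \<eta>)
           \<le> k / (1 - k) * (dist (?X (n - 1)) (?X n) + dist (?Y (n - 1)) (?Y n))) \<and>
        (\<forall>n\<ge>1. dist (?X n) \<xi> + dist (?Y n) \<eta>
           \<le> k * (dist (?X (n - 1)) \<xi> + dist (?Y (n - 1)) \<eta>))"
      by blast
  }
  ultimately show ?thesis
    by blast
qed

end
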